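(* Let $G$ be any graph, let $n \geq 2$, and consider the $n$-cone $\overline{K}_n \vee G$. Let $c_j \coloneqq \max \{j, n + 1 - j + \sigma_{j - \alpha(G)}(G)\}$. \begin{enumerate} \item If $n \geq |V_G|$ then $\sigma(\overline{K}_n \vee G)=\min\limits_{1 \leq j \leq |V_G|} c_j$. \item If $\alpha(G) < n <|V_G|$ then $\sigma(\overline{K}_n \vee G)=\min \left\{ \min\limits_{1 \leq j \leq n} c_j, \sigma_{n+1 - \alpha(G)}(G) \right\}$. \item If $n \leq \alpha(G)$ then \begin{align*} \sigma(\overline{K}_n \vee G) &= \min \left\{ \min\limits_{1 \leq j \leq n} \max \{j, \alpha(G)+1-j\}, \,\sigma(G)\right\} \\ &= \begin{cases} \min \left\{\sigma(G), \left\lceil \frac{\alpha(G)+1}{2} \right\rceil\right\} & \text{if $n > \left\lfloor \frac{\alpha(G)+1}{2} \right\rfloor$,} \\ \min \left\{\sigma(G), \alpha(G)+1-n \right\} &\text{if $n \leq \left\lfloor \frac{\alpha(G)+1}{2} \right\rfloor$.} \end{cases} \end{align*} \end{enumerate}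
   Context: All graphs are finite, undirected and simple. $\overline{K}_n$ denotes the empty (edgeless) graph on $n$ vertices, and $\overline{K}_n\vee G$ (the join of $\overline{K}_n$ with $G$: disjoint union plus all edges between them) is called the $n$-cone of $G$. $\alpha(G)$ is the independence number and $\Delta(G)$ the maximum degree. For a nonempty graph $G=(V,E)$, $\sigma(G)=\min\{\Delta(G[S]) : S\subseteq V,\ |S|>\alpha(G)\}$, and $\sigma(\overline{K}_m)=\infty$. For nonempty $G$ and integer $k\le |V_G|-\alpha(G)$, $\sigma_k(G)=0$ if $k\le 0$ and, for $1\le k\le |V_G|-\alpha(G)$, $\sigma_k(G)$ is the minimum of $\Delta(H)$ over induced subgraphs $H$ of $G$ on $\alpha(G)+k$ vertices; for the empty graph, $\sigma_k(\overline{K}_m)=0$ if $k\le0$ and $\infty$ if $1\le k\le m$. *)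

theory Defs
  imports Complex_Main "HOL-Library.Extended_Nat" "Graph_Theory.Graph_Theory"
begin

text \<open>
  A finite simple undirected graph is a \<open>pair_graph\<close>: a finite, loop-free, symmetric digraph
  without parallel arcs.  Each edge \<open>uv\<close> is represented by the two arcs \<open>(u,v)\<close> and \<open>(v,u)\<close>,
  so the degree of a vertex is its out-degree.
\<close>

definition max_degree :: "('a, 'b) pre_digraph \<Rightarrow> nat" where
  "max_degree G = Max (out_degree G ` verts G)"

definition independent_set :: "('a, 'b) pre_digraph \<Rightarrow> 'a set \<Rightarrow> bool" where
  "independent_set G S \<longleftrightarrow> S \<subseteq> verts G \<and> (\<forall>u\<in>S. \<forall>v\<in>S. (u, v) \<notin> arcs_ends G)"

definition independence_number :: "('a, 'b) pre_digraph \<Rightarrow> nat" where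
  "independence_number G = Max (card ` {S. independent_set G S})"

text \<open>
  ``Empty graph'' means edgeless.  Minima are infima in \<^typ>\<open>enat\<close>; for a finite graph with an
  edge the index set below is finite and nonempty, so the infimum is attained.  Only nonempty
  vertex sets \<open>S\<close> are involved, so \<^const>\<open>max_degree\<close> is never taken of a graph without vertices.
\<close>

definition sigma :: "('a, 'b) pre_digraph \<Rightarrow> enat" where
  "sigma G =
     (if arcs G = {} then \<infinity>
      else INF S \<in> {S. S \<subseteq> verts G \<and> card S > independence_number G}.
             enat (max_degree (G \<restriction> S)))"

text \<open>
  The value for \<open>k > |V| - \<alpha>(G)\<close>, where the mathematical definition leaves a graph with edges
  out, is \<open>\<infinity>\<close> (infimum of the empty set).
\<close>

definition sigma_k :: "int \<Rightarrow> ('a, 'b) pre_digraph \<Rightarrow> enat" where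
  "sigma_k k G =
     (if k \<le> 0 then 0
      else if arcs G = {} then \<infinity>
      else INF S \<in> {S. S \<subseteq> verts G \<and> int (card S) = int (independence_number G) + k}.
             enat (max_degree (G \<restriction> S)))"

definition empty_graph :: "nat \<Rightarrow> nat pair_pre_digraph" where
  "empty_graph n = \<lparr>pverts = {..<n}, parcs = {}\<rparr>"

definition graph_join ::
  "'a pair_pre_digraph \<Rightarrow> 'b pair_pre_digraph \<Rightarrow> ('a + 'b) pair_pre_digraph" where
  "graph_join G H =
     \<lparr>pverts = pverts G <+> pverts H,
      parcs = map_prod Inl Inl ` parcs G \<union> map_prod Inr Inr ` parcs H
        \<union> (Inl ` pverts G) \<times> (Inr ` pverts H) \<union> (Inr ` pverts H) \<times> (Inl ` pverts G)\<rparr>"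

definition cone :: "nat \<Rightarrow> 'a pair_pre_digraph \<Rightarrow> (nat + 'a) pair_pre_digraph" where
  "cone n G = graph_join (empty_graph n) G"

lemma pair_graph_empty_graph: "pair_graph (empty_graph n)"
  by unfold_locales (auto simp: empty_graph_def symmetric_def sym_def)

lemma pair_graph_graph_join:
  assumes "pair_graph G" and "pair_graph H"
  shows "pair_graph (graph_join G H)"
proof -
  interpret G: pair_graph G by fact
  interpret H: pair_graph H by fact
  show ?thesis
    by unfold_locales
      (auto simp: graph_join_def symmetric_def sym_def image_iff G.pair_finite_verts
        H.pair_finite_verts G.pair_finite_arcs H.pair_finite_arcs
        dest: G.in_arcsD1 G.in_arcsD2 H.in_arcsD1 H.in_arcsD2 G.no_loops' H.no_loops'
          G.arcs_symmetric H.arcs_symmetric intro: rev_bexI)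
qed

lemma pair_graph_cone: "pair_graph G \<Longrightarrow> pair_graph (cone n G)"
  unfolding cone_def by (intro pair_graph_graph_join pair_graph_empty_graph)

end

theory Submission
  imports Defs
begin

text \<open>
  Shrinking a vertex set does not increase the maximum degree, so \<open>\<sigma>\<close> of the cone is attained on
  sets \<open>S\<close> of size \<open>m + 1\<close>, where \<open>m = max n \<alpha>(G)\<close> is the independence number of the cone.  If
  \<open>S\<close> has \<open>j\<close> vertices in \<open>G\<close>, inducing \<open>H\<close>, and \<open>m + 1 - j > 0\<close> apexes, then the apexes have
  degree \<open>j\<close> and the other vertices gain \<open>m + 1 - j\<close>; so the best such \<open>S\<close> has maximum degree
  \<open>max j (m + 1 - j + min \<Delta>(H))\<close>.  The three cases differ only in which \<open>j\<close> are possible.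
\<close>

section \<open>Maximum degrees of induced subgraphs\<close>

lemma max_degree_induced:
  assumes "S \<subseteq> pverts G"
  shows "max_degree (with_proj G \<restriction> S) = Max ((\<lambda>v. card {w\<in>S. (v, w) \<in> parcs G}) ` S)"
proof -
  have "out_degree (with_proj G \<restriction> S) v = card {w\<in>S. (v, w) \<in> parcs G}" if "v \<in> S" for v
  proof -
    have "out_arcs (with_proj G \<restriction> S) v = Pair v ` {w\<in>S. (v, w) \<in> parcs G}"
      using that by (auto simp: out_arcs_def)
    then show ?thesis
      by (simp add: out_degree_def card_image inj_on_def)
  qed
  then show ?thesis
    by (simp add: max_degree_def)
qed

text \<open>Deleting vertices can only remove neighbours of the remaining ones. \<open>T\<close> is
  nonempty since \<open>Max\<close> of the empty set is unspecified.\<close>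

lemma max_degree_induced_mono:
  assumes "pair_graph G" "T \<subseteq> S" "S \<subseteq> pverts G" "T \<noteq> {}"
  shows "max_degree (with_proj G \<restriction> T) \<le> max_degree (with_proj G \<restriction> S)"
proof -
  interpret pair_graph G by fact
  have fin: "finite S" "finite T"
    using assms(2,3) finite_subset[OF _ pair_finite_verts] by auto
  have "card {w\<in>T. (v, w) \<in> parcs G} \<le> Max ((\<lambda>v. card {w\<in>S. (v, w) \<in> parcs G}) ` S)"
    if "v \<in> T" for v
  proof -
    have "card {w\<in>T. (v, w) \<in> parcs G} \<le> card {w\<in>S. (v, w) \<in> parcs G}"
      using assms(2) fin by (intro card_mono) auto
    also have "\<dots> \<le> Max ((\<lambda>v. card {w\<in>S. (v, w) \<in> parcs G}) ` S)"
      using fin that assms(2) by (intro Max_ge) auto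
    finally show ?thesis .
  qed
  then have "Max ((\<lambda>v. card {w\<in>T. (v, w) \<in> parcs G}) ` T)
      \<le> Max ((\<lambda>v. card {w\<in>S. (v, w) \<in> parcs G}) ` S)"
    using fin assms(4) by (subst Max_le_iff) auto
  then show ?thesis
    using assms(2,3) max_degree_induced[of T G] max_degree_induced[of S G] by simp
qed

lemma max_degree_independent:
  assumes "independent_set (with_proj G) S" "S \<noteq> {}"
  shows "max_degree (with_proj G \<restriction> S) = 0"
proof -
  have "card {w\<in>S. (v, w) \<in> parcs G} = 0" if "v \<in> S" for v
  proof -
    have "{w\<in>S. (v, w) \<in> parcs G} = {}"
      using assms(1) that by (auto simp: independent_set_def arcs_ends_def arc_to_ends_def)
    then show ?thesis
      by (simp only: card.empty)
  qed
  then have "(\<lambda>v. card {w\<in>S. (v, w) \<in> parcs G}) ` S = (\<lambda>v. 0) ` S"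
    by (rule image_cong[OF refl])
  also have "\<dots> = {0}"
    using assms(2) by auto
  finally have "(\<lambda>v. card {w\<in>S. (v, w) \<in> parcs G}) ` S = {0}" .
  then show ?thesis
    using assms(1) by (simp add: max_degree_induced independent_set_def)
qed

section \<open>Independent sets, \<open>sigma\<close> and \<open>sigma_k\<close> of a single
  graph\<close>

lemma independent_set_pair_iff:
  "independent_set (with_proj G) S \<longleftrightarrow>
     S \<subseteq> pverts G \<and> (\<forall>u\<in>S. \<forall>v\<in>S. (u, v) \<notin> parcs G)"
  by (auto simp: independent_set_def arcs_ends_def arc_to_ends_def)

lemma independent_set_subset:
  "independent_set G S \<Longrightarrow> T \<subseteq> S \<Longrightarrow> independent_set G T"
  by (auto simp: independent_set_def)

context
  fixes G :: "'a pair_pre_digraph"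
  assumes G: "pair_graph G"
begin

lemma finite_pverts: "finite (pverts G)"
proof -
  interpret pair_graph G by (rule G)
  show ?thesis
    by (rule pair_finite_verts)
qed

lemma finite_independent_sets: "finite {S. independent_set (with_proj G) S}"
  by (rule finite_subset[of _ "Pow (pverts G)"]) (auto simp: independent_set_def finite_pverts)

lemma card_le_independence_number:
  "independent_set (with_proj G) S \<Longrightarrow> card S \<le> independence_number (with_proj G)"
  unfolding independence_number_def by (intro Max_ge) (auto simp: finite_independent_sets)

lemma obtains_max_independent_set:
  obtains S where "independent_set (with_proj G) S"
    "card S = independence_number (with_proj G)"
proof -
  have "independent_set (with_proj G) {}"
    by (simp add: independent_set_def)
  then have "independence_number (with_proj G) \<in> card ` {S. independent_set (with_proj G) S}"
    unfolding independence_number_def by (intro Max_in) (auto simp: finite_independent_sets)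
  then show ?thesis
    using that by auto
qed

lemma independence_number_le_card: "independence_number (with_proj G) \<le> card (pverts G)"
proof -
  obtain S where "independent_set (with_proj G) S"
    "card S = independence_number (with_proj G)"
    by (rule obtains_max_independent_set)
  then show ?thesis
    using card_mono[OF finite_pverts, of S] by (simp add: independent_set_def)
qed

lemma independence_number_edgeless:
  "parcs G = {} \<Longrightarrow> independence_number (with_proj G) = card (pverts G)"
  using card_le_independence_number[of "pverts G"] independence_number_le_card
  by (simp add: independent_set_pair_iff)

text \<open>A maximum independent set of full size is the whole vertex set. This identifies the
  boundary case \<alpha>(G) = |V|, where no induced subgraph on \<alpha>(G) + 1 vertices exists and
  \<open>sigma\<close> is infinite.\<close>

lemma edgeless_if_independence_number_eq:
  assumes "independence_number (with_proj G) = card (pverts G)"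
  shows "parcs G = {}"
proof -
  interpret pair_graph G by (rule G)
  obtain S where "independent_set (with_proj G) S"
    "card S = independence_number (with_proj G)"
    by (rule obtains_max_independent_set)
  then have "independent_set (with_proj G) (pverts G)"
    using assms card_subset_eq[OF pair_finite_verts, of S] by (simp add: independent_set_def)
  then have "(u, v) \<notin> parcs G" for u v
    using in_arcsD1[of u v] in_arcsD2[of u v] by (auto simp: independent_set_pair_iff)
  then show ?thesis
    by (metis equals0I surj_pair)
qed

text \<open>Every set with more than \<alpha>(G) vertices contains one with exactly \<alpha>(G) + 1,
  whose maximum degree is no larger. For an edgeless graph both sides are infinite by
  definition.\<close>

lemma sigma_eq_sigma_k: "sigma (with_proj G) = sigma_k 1 (with_proj G)"
proof (cases "parcs G = {}")
  case True
  then show ?thesis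
    by (simp add: sigma_def sigma_k_def)
next
  case False
  define \<alpha> where "\<alpha> = independence_number (with_proj G)"
  let ?D = "\<lambda>S. enat (max_degree (with_proj G \<restriction> S))"
  have "(INF S\<in>{S. S \<subseteq> pverts G \<and> card S > \<alpha>}. ?D S)
      = (INF S\<in>{S. S \<subseteq> pverts G \<and> card S = \<alpha> + 1}. ?D S)"
  proof (rule INF_eq)
    fix S assume S: "S \<in> {S. S \<subseteq> pverts G \<and> card S > \<alpha>}"
    then have "\<alpha> + 1 \<le> card S"
      by simp
    then obtain T where T: "T \<subseteq> S" "card T = \<alpha> + 1"
      by (metis obtain_subset_with_card_n)
    then have "T \<noteq> {}"
      by auto
    with S T show "\<exists>T\<in>{S. S \<subseteq> pverts G \<and> card S = \<alpha> + 1}. ?D T \<le> ?D S"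
      using max_degree_induced_mono[OF G, of T S] by (intro bexI[of _ T]) auto
  qed force
  moreover have "{S. S \<subseteq> pverts G \<and> int (card S) = int \<alpha> + 1}
      = {S. S \<subseteq> pverts G \<and> card S = \<alpha> + 1}"
    by auto
  ultimately show ?thesis
    using False by (simp add: sigma_def sigma_k_def \<alpha>_def)
qed

text \<open>For \<open>j \<le> \<alpha>(G)\<close> the value \<open>\<sigma>\<^sub>k = 0\<close> is realised by part of a maximum independent set, so
  in the whole range \<open>1 \<le> j \<le> |V|\<close> it is the least maximum degree of a \<open>j\<close>-vertex induced
  subgraph.\<close>

lemma
  assumes "1 \<le> j"
  shows sigma_k_le: "A \<subseteq> pverts G \<Longrightarrow> card A = j \<Longrightarrow>
      sigma_k (int j - int (independence_number (with_proj G))) (with_proj G)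
        \<le> enat (max_degree (with_proj G \<restriction> A))" (is "_ \<Longrightarrow> _ \<Longrightarrow> ?s \<le> _")
    and sigma_k_attained: "j \<le> card (pverts G) \<Longrightarrow>
      \<exists>A\<subseteq>pverts G. card A = j \<and>
        sigma_k (int j - int (independence_number (with_proj G))) (with_proj G)
          = enat (max_degree (with_proj G \<restriction> A))"
proof -
  define \<alpha> where "\<alpha> = independence_number (with_proj G)"
  let ?F = "{S. S \<subseteq> pverts G \<and> card S = j}"
  let ?D = "\<lambda>S. enat (max_degree (with_proj G \<restriction> S))"
  have eq: "?s = (INF S\<in>?F. ?D S)" if "\<alpha> < j" "j \<le> card (pverts G)"
  proof -
    \<comment> \<open>An edgeless graph would have \<alpha> = |V|, contradicting \<alpha> < j \<le>
      |V|; so the infinite branch of \<open>sigma_k\<close> does not apply.\<close>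
    have "parcs G \<noteq> {}"
      using that independence_number_edgeless \<alpha>_def by linarith
    moreover have "{S. S \<subseteq> pverts G \<and> int (card S) = int \<alpha> + (int j - int \<alpha>)} = ?F"
      by auto
    ultimately show ?thesis
      using that(1) by (simp add: sigma_k_def flip: \<alpha>_def)
  qed
  {
    assume A: "A \<subseteq> pverts G" "card A = j"
    then have "j \<le> card (pverts G)"
      using card_mono[OF finite_pverts] by blast
    show "?s \<le> ?D A"
    proof (cases "\<alpha> < j")
      case True
      have "(INF S\<in>?F. ?D S) \<le> ?D A"
        using A by (intro INF_lower) simp
      then show ?thesis
        using eq[OF True \<open>j \<le> card (pverts G)\<close>] by simp
    next
      case False
      then show ?thesis
        by (simp add: sigma_k_def \<alpha>_def)
    qed
  }
  assume j: "j \<le> card (pverts G)"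
  show "\<exists>A\<subseteq>pverts G. card A = j \<and> ?s = ?D A"
  proof (cases "\<alpha> < j")
    case True
    obtain A where "A \<subseteq> pverts G" "card A = j"
      by (metis obtain_subset_with_card_n j)
    then have "?D A \<in> ?D ` ?F"
      by blast
    \<comment> \<open>On a nonempty set of \<open>enat\<close> values the infimum is by definition
      the least element, so it is attained.\<close>
    then have "(LEAST d. d \<in> ?D ` ?F) \<in> ?D ` ?F"
      by (rule LeastI)
    moreover from this have "(?D ` ?F = {}) = False"
      by blast
    ultimately have "?s \<in> ?D ` ?F"
      unfolding eq[OF True j] Inf_enat_def by (simp only: if_False)
    then show ?thesis
      by blast
  next
    case False
    obtain S where S: "independent_set (with_proj G) S" "card S = \<alpha>"
      using obtains_max_independent_set \<alpha>_def by auto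
    with False have "j \<le> card S"
      by simp
    then obtain A where A: "A \<subseteq> S" "card A = j"
      by (metis obtain_subset_with_card_n)
    then have ind: "independent_set (with_proj G) A" "A \<noteq> {}"
      using S(1) independent_set_subset assms by auto
    then have "?D A = 0"
      using max_degree_independent by (simp add: zero_enat_def)
    moreover have "?s = 0"
      using False by (simp add: sigma_k_def \<alpha>_def)
    ultimately show ?thesis
      using A ind by (auto simp: independent_set_def intro!: exI[of _ A])
  qed
qed

end

section \<open>The cone: adjacency, independence number, induced degrees and
  \<open>sigma\<close>\<close>

lemma pverts_cone: "pverts (cone n G) = {..<n} <+> pverts G"
  by (simp add: cone_def graph_join_def empty_graph_def)

lemma parcs_cone [simp]:
  "(Inl i, Inl i') \<notin> parcs (cone n G)"
  "(Inl i, Inr v) \<in> parcs (cone n G) \<longleftrightarrow> i < n \<and> v \<in> pverts G"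
  "(Inr v, Inl i) \<in> parcs (cone n G) \<longleftrightarrow> i < n \<and> v \<in> pverts G"
  "(Inr u, Inr v) \<in> parcs (cone n G) \<longleftrightarrow> (u, v) \<in> parcs G"
  by (auto simp: cone_def graph_join_def empty_graph_def)

lemma obtain_Plus_subset:
  assumes "S \<subseteq> A <+> B"
  obtains I J where "I \<subseteq> A" "J \<subseteq> B" "S = I <+> J"
proof (rule that)
  show "Inl -` S \<subseteq> A" "Inr -` S \<subseteq> B"
    using assms by auto
  show "S = (Inl -` S) <+> (Inr -` S)"
    using assms by auto
qed

context
  fixes G :: "'a pair_pre_digraph"
  assumes G: "pair_graph G"
begin

text \<open>Decides which branch of \<open>sigma\<close> applies to the cone: an apex and a vertex
  of \<open>G\<close> always span an edge.\<close>

lemma parcs_cone_empty_iff: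
  assumes "n > 0"
  shows "parcs (cone n G) = {} \<longleftrightarrow> pverts G = {}"
proof
  assume "parcs (cone n G) = {}"
  then have "(Inl 0, Inr v) \<notin> parcs (cone n G)" for v
    by simp
  with assms show "pverts G = {}"
    by auto
next
  interpret pair_graph G by (rule G)
  assume "pverts G = {}"
  then show "parcs (cone n G) = {}"
    using in_arcsD1 by (auto simp: cone_def graph_join_def empty_graph_def)
qed

text \<open>An independent set cannot contain both an apex and a vertex of \<open>G\<close>, as
  these are adjacent. So it lies on one side of the join, and on each side the maximum, n or
  \<alpha>(G), is reached.\<close>

lemma independence_number_cone:
  "independence_number (with_proj (cone n G)) = max n (independence_number (with_proj G))"
proof (rule antisym)
  interpret C: pair_graph "cone n G"
    using G by (rule pair_graph_cone)
  obtain S where S: "independent_set (with_proj (cone n G)) S"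
    "card S = independence_number (with_proj (cone n G))"
    using obtains_max_independent_set[OF C.pair_graph_axioms] by metis
  have "S \<subseteq> {..<n} <+> pverts G"
    using S(1) by (simp add: independent_set_def pverts_cone)
  then obtain I A where IA: "I \<subseteq> {..<n}" "A \<subseteq> pverts G" "S = I <+> A"
    by (rule obtain_Plus_subset)
  have "finite I" "finite A"
    using IA finite_subset finite_pverts[OF G] by blast+
  then have card_S: "card S = card I + card A"
    using IA(3) by (simp add: card_Plus)
  have "I = {} \<or> A = {}"
  proof (rule ccontr)
    assume "\<not> (I = {} \<or> A = {})"
    then obtain i v where "i \<in> I" "v \<in> A"
      by auto
    then have "Inl i \<in> S" "Inr v \<in> S" "(Inl i, Inr v) \<in> parcs (cone n G)"
      unfolding IA(3) using IA(1,2) by auto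
    with S(1) show False
      unfolding independent_set_pair_iff by blast
  qed
  moreover have "card I \<le> n"
    using IA card_mono[of "{..<n}" I] by simp
  moreover have "independent_set (with_proj G) A"
    unfolding independent_set_pair_iff
  proof (intro conjI ballI)
    fix u v assume "u \<in> A" "v \<in> A"
    then have "Inr u \<in> S" "Inr v \<in> S"
      unfolding IA(3) by auto
    then have "(Inr u, Inr v) \<notin> parcs (cone n G)"
      using S(1) unfolding independent_set_pair_iff by blast
    then show "(u, v) \<notin> parcs G"
      by simp
  qed (rule IA(2))
  ultimately show "independence_number (with_proj (cone n G))
      \<le> max n (independence_number (with_proj G))"
    using card_le_independence_number[OF G, of A] card_S S(2) by auto
next
  have le: "card T \<le> independence_number (with_proj (cone n G))"
    if "independent_set (with_proj (cone n G)) T" for T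
    using card_le_independence_number[OF pair_graph_cone[OF G] that] .
  obtain S where S: "independent_set (with_proj G) S"
    "card S = independence_number (with_proj G)"
    by (rule obtains_max_independent_set[OF G])
  have "independent_set (with_proj (cone n G)) (Inr ` S)"
    using S(1) by (auto simp: independent_set_pair_iff pverts_cone)
  then have "independence_number (with_proj G) \<le> independence_number (with_proj (cone n G))"
    using le[of "Inr ` S"] S(2) by (simp add: card_image)
  moreover have "independent_set (with_proj (cone n G)) (Inl ` {..<n})"
    by (auto simp: independent_set_pair_iff pverts_cone)
  then have "n \<le> independence_number (with_proj (cone n G))"
    using le[of "Inl ` {..<n}"] by (simp add: card_image)
  ultimately show "max n (independence_number (with_proj G))
      \<le> independence_number (with_proj (cone n G))"
    by simp
qed

text \<open>An apex in \<open>I\<close> has exactly \<open>A\<close> as its neighbourhood, and each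
  vertex of \<open>A\<close> gains all of \<open>I\<close>. With no apex chosen, no vertex
  contributes the degree \<open>card A\<close>, hence the case distinction.\<close>

lemma max_degree_induced_cone:
  assumes "I \<subseteq> {..<n}" "A \<subseteq> pverts G" "A \<noteq> {}"
  shows "max_degree (with_proj (cone n G) \<restriction> (I <+> A)) =
    (if I = {} then max_degree (with_proj G \<restriction> A)
     else max (card A) (card I + max_degree (with_proj G \<restriction> A)))"
proof -
  have fin: "finite I" "finite A"
    using assms finite_subset finite_pverts[OF G] by blast+
  let ?C = "\<lambda>x. card {y \<in> I <+> A. (x, y) \<in> parcs (cone n G)}"
  let ?g = "\<lambda>v. card {w\<in>A. (v, w) \<in> parcs G}"
  have Inl: "?C (Inl i) = card A" if "i \<in> I" for i
  proof -
    have "{y \<in> I <+> A. (Inl i, y) \<in> parcs (cone n G)} = Inr ` A"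
      using that assms by auto
    then show ?thesis
      by (simp add: card_image)
  qed
  have Inr: "?C (Inr v) = card I + ?g v" if "v \<in> A" for v
  proof -
    have "{y \<in> I <+> A. (Inr v, y) \<in> parcs (cone n G)} = I <+> {w\<in>A. (v, w) \<in> parcs G}"
      using that assms by auto
    then show ?thesis
      using fin by (simp add: card_Plus)
  qed
  have "?C ` (I <+> A) = (\<lambda>_. card A) ` I \<union> (\<lambda>v. card I + ?g v) ` A"
    using Inl Inr by (simp add: Plus_def image_Un image_image cong: image_cong)
  moreover have "Max ((\<lambda>v. card I + ?g v) ` A) = card I + Max (?g ` A)"
    using fin assms(3) Max_add_commute[of A ?g "card I"] by (simp add: add.commute)
  ultimately have "Max (?C ` (I <+> A)) =
      (if I = {} then Max (?g ` A) else max (card A) (card I + Max (?g ` A)))"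
    using fin assms(3) by (auto simp: Max_Un image_constant_conv)
  moreover have "I <+> A \<subseteq> pverts (cone n G)"
    using assms by (auto simp: pverts_cone)
  ultimately show ?thesis
    using assms(2) by (simp add: max_degree_induced)
qed

text \<open>One formula serving all ranges of n: j counts the chosen vertices of \<open>G\<close>,
  and m + 1 \<le> j + n says that the n apexes suffice to fill up to m + 1. At j = m + 1 no apex is
  used, so the apex degree j must not enter the value.\<close>

lemma sigma_cone:
  fixes n :: nat
  defines "\<alpha> \<equiv> independence_number (with_proj G)"
  defines "m \<equiv> max n \<alpha>"
  assumes "n > 0"
  shows "sigma (with_proj (cone n G)) =
    (INF j\<in>{j. 1 \<le> j \<and> j \<le> card (pverts G) \<and> j \<le> m + 1 \<and> m + 1 \<le> j + n}.
      if j = m + 1 then sigma_k (int j - int \<alpha>) (with_proj G)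
      else max (enat j) (enat (m + 1 - j) + sigma_k (int j - int \<alpha>) (with_proj G)))"
    (is "_ = (INF j\<in>?J. ?f j)")
proof (cases "pverts G = {}")
  case True
  \<comment> \<open>Without vertices in \<open>G\<close> the cone is edgeless and its
    \<open>sigma\<close> is infinite, which is also the infimum over the empty index set.\<close>
  then have "?J = {}"
    by auto
  moreover have "sigma (with_proj (cone n G)) = top"
    using True parcs_cone_empty_iff assms by (simp add: sigma_def top_enat_def)
  ultimately show ?thesis
    by (simp only: image_empty Inf_empty)
next
  case False
  then have ne: "parcs (cone n G) \<noteq> {}"
    using parcs_cone_empty_iff assms by blast
  let ?D = "\<lambda>S. enat (max_degree (with_proj (cone n G) \<restriction> S))"
  let ?F = "{S. S \<subseteq> {..<n} <+> pverts G \<and> card S = m + 1}"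
  have "sigma (with_proj (cone n G)) = sigma_k 1 (with_proj (cone n G))"
    by (rule sigma_eq_sigma_k[OF pair_graph_cone[OF G]])
  also have "\<dots> = (INF S\<in>{S. S \<subseteq> {..<n} <+> pverts G \<and> int (card S) = int m + 1}. ?D S)"
    using ne by (simp add: sigma_k_def independence_number_cone pverts_cone m_def \<alpha>_def)
  also have "{S. S \<subseteq> {..<n} <+> pverts G \<and> int (card S) = int m + 1} = ?F"
    by auto
  also have "(INF S\<in>?F. ?D S) = (INF j\<in>?J. ?f j)"
  proof (rule INF_eq)
    fix S assume "S \<in> ?F"
    then have "S \<subseteq> {..<n} <+> pverts G" and S: "card S = m + 1"
      by auto
    from this(1) obtain I A where IA: "I \<subseteq> {..<n}" "A \<subseteq> pverts G" "S = I <+> A"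
      by (rule obtain_Plus_subset)
    have fin: "finite I" "finite A"
      using IA finite_subset finite_pverts[OF G] by blast+
    then have sum: "card I + card A = m + 1"
      using IA S by (simp add: card_Plus)
    have I: "card I \<le> n"
      using IA card_mono[of "{..<n}" I] by simp
    have A: "card A \<le> card (pverts G)"
      using IA card_mono[OF finite_pverts[OF G]] by blast
    \<comment> \<open>Since m \<ge> n, a set of m + 1 vertices cannot consist of apexes
      alone.\<close>
    have "1 \<le> card A"
      using sum I by (simp add: m_def)
    then have "A \<noteq> {}"
      by auto
    have le: "sigma_k (int (card A) - int \<alpha>) (with_proj G) \<le> enat (max_degree (with_proj G \<restriction> A))"
      using sigma_k_le[OF G \<open>1 \<le> card A\<close>] IA by (simp add: \<alpha>_def)
    have "?f (card A) \<le> ?D S"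
    proof (cases "I = {}")
      case True
      then show ?thesis
        using le sum max_degree_induced_cone[OF IA(1,2) \<open>A \<noteq> {}\<close>] IA(3) by simp
    next
      case False
      then have "card I > 0"
        using fin by auto
      then have "m + 1 - card A = card I" "card A \<noteq> m + 1"
        using sum by auto
      moreover have "?D S = max (enat (card A))
          (enat (card I) + enat (max_degree (with_proj G \<restriction> A)))"
        using False max_degree_induced_cone[OF IA(1,2) \<open>A \<noteq> {}\<close>] IA(3) by simp
      moreover have "max (enat (card A)) (enat (card I) + sigma_k (int (card A) - int \<alpha>) (with_proj G))
          \<le> max (enat (card A)) (enat (card I) + enat (max_degree (with_proj G \<restriction> A)))"
        by (rule max.mono[OF order_refl add_left_mono[OF le]])
      ultimately show ?thesis
        by (simp only: if_False)
    qed
    moreover have "card A \<in> ?J"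
      using sum I A \<open>1 \<le> card A\<close> by simp
    ultimately show "\<exists>j\<in>?J. ?f j \<le> ?D S"
      by blast
  next
    \<comment> \<open>Conversely, a \<open>j\<close>-vertex set attaining \<open>sigma_k\<close>
      together with any m + 1 - j apexes realises the value at j.\<close>
    fix j assume j: "j \<in> ?J"
    then obtain A where A: "A \<subseteq> pverts G" "card A = j"
      "sigma_k (int j - int \<alpha>) (with_proj G) = enat (max_degree (with_proj G \<restriction> A))"
      using sigma_k_attained[OF G, of j] by (auto simp: \<alpha>_def)
    have "m + 1 - j \<le> card {..<n}"
      using j by auto
    then obtain I where I: "I \<subseteq> {..<n}" "card I = m + 1 - j"
      by (metis obtain_subset_with_card_n)
    have fin: "finite I" "finite A"
      using I A finite_subset finite_pverts[OF G] by blast+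
    have "A \<noteq> {}"
      using A j by auto
    have "I = {} \<longleftrightarrow> j = m + 1"
      using I(2) fin j by (auto simp flip: card_0_eq)
    then have "?D (I <+> A) = ?f j"
      using max_degree_induced_cone[OF I(1) A(1) \<open>A \<noteq> {}\<close>] A I by auto
    moreover have "I <+> A \<in> ?F"
      using fin I A j by (auto simp: card_Plus)
    ultimately show "\<exists>S\<in>?F. ?D S \<le> ?f j"
      using order_eq_refl by (intro bexI[of _ "I <+> A"])
  qed
  finally show ?thesis .
qed

end

section \<open>Evaluation in the three ranges of n\<close>

lemma INF_max_complement:
  fixes n \<alpha> :: nat
  assumes "1 \<le> n" "n \<le> \<alpha>"
  shows "(INF j\<in>{1..n}. enat (max j (\<alpha> + 1 - j))) =
    (if n > (\<alpha> + 1) div 2 then enat ((\<alpha> + 2) div 2) else enat (\<alpha> + 1 - n))"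
proof (cases "n > (\<alpha> + 1) div 2")
  case True
  \<comment> \<open>The numbers j and \<alpha> + 1 - j sum to \<alpha> + 1, so the larger is at
    least half of it, rounded up. Taking j as half of \<alpha> + 1 rounded down, which lies below n
    here, attains this bound.\<close>
  have "(INF j\<in>{1..n}. enat (max j (\<alpha> + 1 - j))) = enat ((\<alpha> + 2) div 2)"
  proof (rule antisym)
    have "max ((\<alpha> + 1) div 2) (\<alpha> + 1 - (\<alpha> + 1) div 2) = (\<alpha> + 2) div 2"
      by linarith
    then show "(INF j\<in>{1..n}. enat (max j (\<alpha> + 1 - j))) \<le> enat ((\<alpha> + 2) div 2)"
      using True assms by (intro INF_lower2[of "(\<alpha> + 1) div 2"]) auto
  qed (intro INF_greatest, auto)
  with True show ?thesis
    by simp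
next
  case False
  \<comment> \<open>Now j \<le> \<alpha> + 1 - j throughout the range, so the maximum is \<alpha> +
    1 - j, which is smallest at j = n.\<close>
  have "(INF j\<in>{1..n}. enat (max j (\<alpha> + 1 - j))) = enat (\<alpha> + 1 - n)"
    using False assms by (intro antisym INF_lower2[of n] INF_greatest) auto
  with False show ?thesis
    by simp
qed

theorem theorem3p7:
  fixes G :: "'a pair_pre_digraph" and n :: nat and c :: "nat \<Rightarrow> enat" and \<alpha> :: nat
  assumes "pair_graph G"
    and "n \<ge> 2"
    and "\<alpha> = independence_number (with_proj G)"
    and "\<And>j. c j = max (enat j) (enat (n + 1 - j) + sigma_k (int j - int \<alpha>) (with_proj G))"
  shows
    "(n \<ge> card (pverts G) \<longrightarrow>
        sigma (with_proj (cone n G)) = (INF j\<in>{1..card (pverts G)}. c j))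
     \<and> (\<alpha> < n \<and> n < card (pverts G) \<longrightarrow>
        sigma (with_proj (cone n G)) =
          min (INF j\<in>{1..n}. c j) (sigma_k (int n + 1 - int \<alpha>) (with_proj G)))
     \<and> (n \<le> \<alpha> \<longrightarrow>
        sigma (with_proj (cone n G)) =
          min (INF j\<in>{1..n}. enat (max j (\<alpha> + 1 - j))) (sigma (with_proj G))
        \<and> min (INF j\<in>{1..n}. enat (max j (\<alpha> + 1 - j))) (sigma (with_proj G)) =
          (if int n > \<lfloor>(real \<alpha> + 1) / 2\<rfloor>
           then min (sigma (with_proj G)) (enat (nat \<lceil>(real \<alpha> + 1) / 2\<rceil>))
           else min (sigma (with_proj G)) (enat (\<alpha> + 1 - n))))"
proof (intro conjI impI)
  let ?s = "\<lambda>j. sigma_k (int j - int \<alpha>) (with_proj G)"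
  let ?V = "card (pverts G)"
  note cone = sigma_cone[OF assms(1), of n, folded assms(3)]
  have \<alpha>: "\<alpha> \<le> ?V"
    using independence_number_le_card[OF assms(1)] assms(3) by simp
  {
    assume "?V \<le> n"
    \<comment> \<open>Here m = n, so the apex bound reduces to j \<ge> 1. As |V| < n + 1, the
      apex-free index j = n + 1 does not occur.\<close>
    then have "{j. 1 \<le> j \<and> j \<le> ?V \<and> j \<le> max n \<alpha> + 1 \<and> max n \<alpha> + 1 \<le> j + n} = {1..?V}"
      and "max n \<alpha> = n"
      using \<alpha> by auto
    then show "sigma (with_proj (cone n G)) = (INF j\<in>{1..?V}. c j)"
      using cone assms(2,4) \<open>?V \<le> n\<close> by (auto intro!: INF_cong)
  next
    assume n: "\<alpha> < n \<and> n < ?V"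
    \<comment> \<open>Now \<open>G\<close> has n + 1 vertices to spare, and the apex-free index j =
      n + 1 supplies the separate \<open>sigma_k\<close> term.\<close>
    then have "{j. 1 \<le> j \<and> j \<le> ?V \<and> j \<le> max n \<alpha> + 1 \<and> max n \<alpha> + 1 \<le> j + n}
        = insert (n + 1) {1..n}"
      and "max n \<alpha> = n"
      by auto
    then have "sigma (with_proj (cone n G)) = min (?s (n + 1)) (INF j\<in>{1..n}. c j)"
      using cone assms(2,4) by (auto simp: inf_min intro!: INF_cong arg_cong2[where f=min])
    then show "sigma (with_proj (cone n G)) =
        min (INF j\<in>{1..n}. c j) (sigma_k (int n + 1 - int \<alpha>) (with_proj G))"
      by (simp add: min.commute add.commute)
  next
    assume n: "n \<le> \<alpha>"
    then have max: "max n \<alpha> = \<alpha>"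
      by simp
    let ?J = "{j. 1 \<le> j \<and> j \<le> ?V \<and> j \<le> \<alpha> + 1 \<and> \<alpha> + 1 \<le> j + n}"
    let ?f = "\<lambda>j. if j = \<alpha> + 1 then ?s j else max (enat j) (enat (\<alpha> + 1 - j) + ?s j)"
    let ?h = "\<lambda>j. enat (max j (\<alpha> + 1 - j))"
    have sig: "sigma (with_proj G) = ?s (\<alpha> + 1)"
      using sigma_eq_sigma_k[OF assms(1)] by simp
    \<comment> \<open>The apex-free term j = \<alpha> + 1, which is \<open>sigma\<close> of
      \<open>G\<close>, is split off. If \<alpha> = |V| this index is missing, but then the term is
      infinite and neutral in the minimum.\<close>
    have "(INF j\<in>?J. ?f j) = min (INF j\<in>{\<alpha> + 1 - n..\<alpha>}. ?f j) (?s (\<alpha> + 1))"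
    proof (cases "\<alpha> < ?V")
      case True
      then have "?J = insert (\<alpha> + 1) {\<alpha> + 1 - n..\<alpha>}"
        using n by auto
      then have "(INF j\<in>?J. ?f j) = inf (?f (\<alpha> + 1)) (INF j\<in>{\<alpha> + 1 - n..\<alpha>}. ?f j)"
        by (simp only: INF_insert)
      then show ?thesis
        by (simp only: inf_min min.commute if_True refl)
    next
      case False
      then have "parcs G = {}"
        using edgeless_if_independence_number_eq[OF assms(1)] assms(3) \<alpha> by simp
      then have "?s (\<alpha> + 1) = top"
        by (simp add: sigma_k_def top_enat_def)
      moreover have "?J = {\<alpha> + 1 - n..\<alpha>}"
        using False \<alpha> n by auto
      then have "(INF j\<in>?J. ?f j) = (INF j\<in>{\<alpha> + 1 - n..\<alpha>}. ?f j)"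
        by (rule arg_cong)
      ultimately show ?thesis
        by (simp only: inf_min[symmetric] inf_top_right)
    qed
    \<comment> \<open>For j \<le> \<alpha> the \<open>sigma_k\<close> summand is 0.\<close>
    also have "(INF j\<in>{\<alpha> + 1 - n..\<alpha>}. ?f j) = (INF j\<in>{\<alpha> + 1 - n..\<alpha>}. ?h j)"
      by (intro INF_cong) (auto simp: sigma_k_def max_def)
    \<comment> \<open>Reflecting j to \<alpha> + 1 - j counts apexes instead of vertices of
      \<open>G\<close>; the maximum is symmetric under this exchange.\<close>
    also have "{\<alpha> + 1 - n..\<alpha>} = (\<lambda>j. \<alpha> + 1 - j) ` {1..n}"
    proof (intro subset_antisym subsetI)
      fix j assume "j \<in> {\<alpha> + 1 - n..\<alpha>}"
      then show "j \<in> (\<lambda>j. \<alpha> + 1 - j) ` {1..n}"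
        using n by (intro image_eqI[of _ _ "\<alpha> + 1 - j"]) auto
    qed (use n in auto)
    also have "(INF j\<in>\<dots>. ?h j) = (INF j\<in>{1..n}. ?h j)"
      unfolding image_image using n by (intro INF_cong) (auto simp: max.commute)
    finally show "sigma (with_proj (cone n G)) =
        min (INF j\<in>{1..n}. ?h j) (sigma (with_proj G))"
      using cone assms(2) sig max by simp
    have "\<lfloor>(real \<alpha> + 1) / 2\<rfloor> = int ((\<alpha> + 1) div 2)"
      using floor_divide_of_nat_eq[of "\<alpha> + 1" 2, where 'a=real] by (simp add: add.commute)
    moreover have "nat \<lceil>(real \<alpha> + 1) / 2\<rceil> = (\<alpha> + 2) div 2"
    proof -
      \<comment> \<open>These bounds put (\<alpha> + 1) / 2 at most at q = (\<alpha> + 2) div 2 and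
        strictly above q - 1, which characterises q as the ceiling.\<close>
      have "2 * ((\<alpha> + 2) div 2) \<le> \<alpha> + 2" "\<alpha> + 1 \<le> 2 * ((\<alpha> + 2) div 2)"
        by linarith+
      then have "2 * real ((\<alpha> + 2) div 2) \<le> real \<alpha> + 2"
        "real \<alpha> + 1 \<le> 2 * real ((\<alpha> + 2) div 2)"
        by linarith+
      then have "\<lceil>(real \<alpha> + 1) / 2\<rceil> = int ((\<alpha> + 2) div 2)"
        by (simp add: ceiling_eq_iff field_simps)
      then show ?thesis
        by (simp only: nat_int)
    qed
    ultimately show "min (INF j\<in>{1..n}. ?h j) (sigma (with_proj G)) =
          (if int n > \<lfloor>(real \<alpha> + 1) / 2\<rfloor>
           then min (sigma (with_proj G)) (enat (nat \<lceil>(real \<alpha> + 1) / 2\<rceil>))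
           else min (sigma (with_proj G)) (enat (\<alpha> + 1 - n)))"
      using INF_max_complement[OF _ n] assms(2) by (simp add: min.commute)
  }
qed

end
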